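(* The following statements on a curve $\gamma\in\mathcal{M}$ are equivalent: (i) $\gamma$ is an $E_{d+1}$ critical curve constrained by $E_1,\dots,E_d$. (ii) The lowest order flow $\xi'=V_0(\xi)$ admits a solution $\xi=\sum_{k=0}^d\xi_k\lambda^{-k}$ on $\Lambda_d^{\mathbb{R}}$ with $(\xi,\xi)=1$. The relation between the curve $\gamma$ and the solution $\xi$ is given by $\gamma'=\xi_0$.
   Context: Let $M\cong\mathbb{R}$ be an oriented 1-manifold with a fixed translation $\tau\in\mathrm{Diff}(M)$, $M/\tau\cong S^1$. Let $h(p)=Ap+a$ be an orientation preserving Euclidean motion ($A\in SO(3)$, $a\in\mathbb{R}^3$), and let $\mathcal{M}$ be the space of smooth immersions $\gamma\colon M\to\mathbb{R}^3$ with monodromy $h$, that is, $\gamma\circ\tau=h\circ\gamma$. Let $(\ )'$ be the derivative with respect to arclength of $\gamma$, and $T=\gamma'$. Let $d\in\mathbb{N}$. The vector fields $Y_k$, $k\ge0$, on $\mathcal{M}$ are defined by $Y_0=T$, $Y_{k+1}=T\times Y_k'-\frac12\sum_{i=1}^k(Y_i,Y_{k-i+1})T$; they satisfy $Y_k'+T\times Y_{k+1}=0$. $E_k\colon\mathcal{M}\to\mathbb{R}$ denotes the (putative) Hamiltonian for $Y_k$, with variational gradient $G_k=T\times Y_k$ (so $G_{k+1}=-Y_k'$). A curve $\gamma$ is $E_{d+1}$ critical constrained by $E_1,\dots,E_d$ if $G_{d+1}=\sum_{i=1}^dc_iG_i$ holds along $\gamma$ for some constants $c_i\in\mathbb{R}$.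 $\Lambda_d^{\mathbb{R}}$ is the space of Laurent polynomials $\xi=\sum_{k=0}^d\xi_k\lambda^{-k}$ with coefficients $\xi_k\in\mathbb{R}^3$. The inner product and the cross product of $\mathbb{R}^3$ are extended pointwise in $\lambda$, so $(\xi,\xi)=\sum_{k,l}(\xi_k,\xi_l)\lambda^{-k-l}$. The vector field $V_0$ is $V_0(\xi)=\xi\times(\lambda\xi)_+$, where $(\ )_+$ denotes the part with strictly positive powers of $\lambda$; thus $V_0(\xi)=\xi\times\lambda\xi_0$ on $\Lambda_d^{\mathbb{R}}$.
   Formalization: The condition (ξ,ξ)=1 is imposed only on the λ^0 coefficient, i.e. |ξ_0|=1; imposed on all coefficients with real ξ_k it forces ξ=ξ_0 and γ a straight line, so the unit circle with d=1 would satisfy (i) but not (ii). *)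

theory Defs
  imports "HOL-Analysis.Analysis"
begin

definition vderiv :: "(real \<Rightarrow> 'a::real_normed_vector) \<Rightarrow> real \<Rightarrow> 'a" where
  "vderiv f t = vector_derivative f (at t)"

definition smooth :: "(real \<Rightarrow> 'a::real_normed_vector) \<Rightarrow> bool" where
  "smooth f \<longleftrightarrow> (\<forall>n t. (vderiv ^^ n) f differentiable (at t))"

text \<open>
  The oriented 1-manifold M is the real line with its standard orientation (a global oriented
  coordinate). A translation of M is a diffeomorphism without fixed points: it is then strictly
  increasing with unbounded orbits, so it acts freely and properly discontinuously and the
  quotient is a circle.
\<close>

definition translation :: "(real \<Rightarrow> real) \<Rightarrow> bool" where
  "translation \<tau> \<longleftrightarrow> bij \<tau> \<and> smooth \<tau> \<and> smooth (inv \<tau>) \<and> (\<forall>t. \<tau> t \<noteq> t)"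

definition motion :: "real^3^3 \<Rightarrow> real^3 \<Rightarrow> real^3 \<Rightarrow> real^3" where
  "motion A a p = A *v p + a"

definition immersions_with_monodromy ::
    "(real \<Rightarrow> real) \<Rightarrow> (real^3 \<Rightarrow> real^3) \<Rightarrow> (real \<Rightarrow> real^3) set" where
  "immersions_with_monodromy \<tau> h =
     {\<gamma>. smooth \<gamma> \<and> (\<forall>t. vderiv \<gamma> t \<noteq> 0) \<and> \<gamma> \<circ> \<tau> = h \<circ> \<gamma>}"

definition arc_deriv ::
    "(real \<Rightarrow> real^3) \<Rightarrow> (real \<Rightarrow> 'a::real_normed_vector) \<Rightarrow> real \<Rightarrow> 'a" where
  "arc_deriv \<gamma> f t = (1 / norm (vderiv \<gamma> t)) *\<^sub>R vderiv f t"

definition tangent :: "(real \<Rightarrow> real^3) \<Rightarrow> real \<Rightarrow> real^3" where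
  "tangent \<gamma> = arc_deriv \<gamma> \<gamma>"

fun Y_field :: "(real \<Rightarrow> real^3) \<Rightarrow> nat \<Rightarrow> real \<Rightarrow> real^3" where
  "Y_field \<gamma> 0 = tangent \<gamma>"
| "Y_field \<gamma> (Suc k) = (\<lambda>t. cross3 (tangent \<gamma> t) (arc_deriv \<gamma> (Y_field \<gamma> k) t)
     - ((1/2) * (\<Sum>i\<in>{1..k}. Y_field \<gamma> i t \<bullet> Y_field \<gamma> (k - i + 1) t)) *\<^sub>R tangent \<gamma> t)"

definition G_gradient :: "(real \<Rightarrow> real^3) \<Rightarrow> nat \<Rightarrow> real \<Rightarrow> real^3" where
  "G_gradient \<gamma> k t = cross3 (tangent \<gamma> t) (Y_field \<gamma> k t)"

text \<open>
  Criticality for the functional with index d + 1, constrained by those with indices 1 to d,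
  in terms of the variational gradients; the constants are the Lagrange multipliers.
\<close>

definition constrained_critical :: "nat \<Rightarrow> (real \<Rightarrow> real^3) \<Rightarrow> bool" where
  "constrained_critical d \<gamma> \<longleftrightarrow>
     (\<exists>c :: nat \<Rightarrow> real. \<forall>t. G_gradient \<gamma> (d + 1) t = (\<Sum>i\<in>{1..d}. c i *\<^sub>R G_gradient \<gamma> i t))"

text \<open>
  A Laurent polynomial is represented by its coefficient function: \<open>\<xi> n\<close> is the coefficient of
  the n-th power of the parameter \<open>\<lambda>\<close>. In the notation with coefficients of negative
  powers, the k-th coefficient is \<open>\<xi> (- int k)\<close>. The sums below run over the (finite) support of
  the first argument.
\<close>

definition laurent_space :: "nat \<Rightarrow> (int \<Rightarrow> real^3) set" where
  "laurent_space d = {\<xi>. \<forall>n. n \<notin> {- int d..0} \<longrightarrow> \<xi> n = 0}"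

definition laurent_inner :: "(int \<Rightarrow> real^3) \<Rightarrow> (int \<Rightarrow> real^3) \<Rightarrow> int \<Rightarrow> real" where
  "laurent_inner \<xi> \<eta> n = (\<Sum>m | \<xi> m \<noteq> 0. \<xi> m \<bullet> \<eta> (n - m))"

definition laurent_cross :: "(int \<Rightarrow> real^3) \<Rightarrow> (int \<Rightarrow> real^3) \<Rightarrow> int \<Rightarrow> real^3" where
  "laurent_cross \<xi> \<eta> n = (\<Sum>m | \<xi> m \<noteq> 0. cross3 (\<xi> m) (\<eta> (n - m)))"

definition lambda_mult :: "(int \<Rightarrow> real^3) \<Rightarrow> int \<Rightarrow> real^3" where
  "lambda_mult \<xi> n = \<xi> (n - 1)"

definition positive_part :: "(int \<Rightarrow> real^3) \<Rightarrow> int \<Rightarrow> real^3" where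
  "positive_part \<xi> n = (if n > 0 then \<xi> n else 0)"

definition V0 :: "(int \<Rightarrow> real^3) \<Rightarrow> int \<Rightarrow> real^3" where
  "V0 \<xi> = laurent_cross \<xi> (positive_part (lambda_mult \<xi>))"

definition solves_V0_flow ::
    "nat \<Rightarrow> (real \<Rightarrow> real^3) \<Rightarrow> (real \<Rightarrow> int \<Rightarrow> real^3) \<Rightarrow> bool" where
  "solves_V0_flow d \<gamma> \<xi> \<longleftrightarrow>
     (\<forall>t. \<xi> t \<in> laurent_space d) \<and>
     (\<forall>n t. (\<lambda>s. \<xi> s n) differentiable (at t) \<and> arc_deriv \<gamma> (\<lambda>s. \<xi> s n) t = V0 (\<xi> t) n)"

text \<open>
  The normalisation of solutions: the value of \<open>(\<xi>, \<xi>)\<close> at \<open>\<lambda> = \<infinity>\<close>, that is, its coefficient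
  at the zeroth power, is 1. The equation \<open>(\<xi>, \<xi>) = 1\<close> cannot be imposed on the remaining
  coefficients as well: \<open>\<xi>\<close> has real coefficients, so by the lemma below it would then be
  constant in \<open>\<lambda>\<close>, and the flow would only produce straight lines.
\<close>

definition normalized :: "(int \<Rightarrow> real^3) \<Rightarrow> bool" where
  "normalized \<xi> \<longleftrightarrow> laurent_inner \<xi> \<xi> 0 = 1"

lemma laurent_inner_one_imp_constant:
  assumes "\<xi> \<in> laurent_space d"
    and "\<And>n. laurent_inner \<xi> \<xi> n = (if n = 0 then 1 else 0)"
    and "n \<noteq> 0"
  shows "\<xi> n = 0"
proof (rule ccontr)
  assume nz: "\<xi> n \<noteq> 0"
  define S where "S = {m. \<xi> m \<noteq> 0}"
  have sub: "S \<subseteq> {- int d..0}"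
    using assms(1) by (auto simp: S_def laurent_space_def)
  hence fin: "finite S"
    by (rule finite_subset) simp
  define p where "p = Min S"
  have "n \<in> S"
    using nz by (simp add: S_def)
  hence pS: "p \<in> S" and "p \<le> n"
    using fin by (auto simp: p_def intro: Min_in)
  moreover have "n < 0"
    using \<open>n \<in> S\<close> sub assms(3) by force
  ultimately have "p < 0"
    by simp
  have below: "\<xi> m = 0" if "m < p" for m
  proof (rule ccontr)
    assume "\<xi> m \<noteq> 0"
    hence "p \<le> m"
      unfolding p_def by (intro Min_le fin) (simp add: S_def)
    with that show False
      by simp
  qed
  have "laurent_inner \<xi> \<xi> (p + p) = (\<Sum>m\<in>S. \<xi> m \<bullet> \<xi> (p + p - m))"
    by (simp add: laurent_inner_def S_def)
  also have "\<dots> = (\<Sum>m\<in>{p}. \<xi> m \<bullet> \<xi> (p + p - m))"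
  proof (rule sum.mono_neutral_right[OF fin])
    show "\<forall>m\<in>S - {p}. \<xi> m \<bullet> \<xi> (p + p - m) = 0"
    proof
      fix m assume "m \<in> S - {p}"
      hence "p \<le> m" "m \<noteq> p"
        using fin by (auto simp: p_def)
      thus "\<xi> m \<bullet> \<xi> (p + p - m) = 0"
        using below[of "p + p - m"] by simp
    qed
  qed (use pS in simp)
  finally have "\<xi> p \<bullet> \<xi> p = 0"
    using assms(2)[of "p + p"] \<open>p < 0\<close> by simp
  thus False
    using pS by (simp add: S_def)
qed

end

theory Submission
  imports Defs
begin

text \<open>
  Write \<open>D\<close> for the derivative with respect to arclength and \<open>x k\<close> for the coefficient of the
  power \<open>-k\<close> of a Laurent polynomial. The lowest order flow with \<open>x 0 = T\<close> is then the chain of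
  equations \<open>D (x k) = - T \<times> x (k + 1)\<close>, closed by the condition \<open>x (d + 1) = 0\<close>. The fields
  \<open>Y k\<close> satisfy the same chain (\<open>arc_deriv_Y\<close>) without ever terminating, and the theorem compares
  the two.

  The chain determines \<open>x (k + 1)\<close> from \<open>x k\<close> up to a multiple of \<open>T\<close>. This multiple has to be
  constant: the derivative of the next coefficient is again a cross product with \<open>T\<close>, hence has no
  tangential component. So the coefficients of every solution are
  \<open>x k = a 0 * Y k + a 1 * Y (k - 1) + ... + a k * Y 0\<close> with constants \<open>a 0 = 1, a 1, a 2, ...\<close>
  (\<open>eq_Y_combination\<close>), and conversely every such combination satisfies the chain
  (\<open>arc_deriv_Y_combination\<close>): formally, solutions are \<open>Y\<close> times a power series in the inverse of
  \<open>\<lambda>\<close> with constant coefficients.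

  The chain can be cut off after \<open>x d\<close> exactly if the normal part of \<open>x (d + 1)\<close> vanishes. As the
  normal part of \<open>Y i\<close> is, up to a rotation, the gradient \<open>G i = T \<times> Y i\<close>, this says that
  \<open>G (d + 1)\<close> is the combination of \<open>G 1, ..., G d\<close> with multipliers \<open>c i = - a (d + 1 - i)\<close>
  (\<open>constrained_critical_iff\<close>).
\<close>

section \<open>Closure properties of smooth functions\<close>

text \<open>
  The number of derivatives is made explicit so that closure under products can be proved by
  induction on it: the derivatives of a product are not products but sums of products.
\<close>

definition times_differentiable :: "nat \<Rightarrow> (real \<Rightarrow> 'a::real_normed_vector) \<Rightarrow> bool" where
  "times_differentiable n f \<longleftrightarrow> (\<forall>k\<le>n. \<forall>t. (vderiv ^^ k) f differentiable (at t))"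

lemma times_differentiable_0:
  "times_differentiable 0 f \<longleftrightarrow> (\<forall>t. f differentiable (at t))"
  by (simp add: times_differentiable_def)

lemma times_differentiable_Suc:
  "times_differentiable (Suc n) f \<longleftrightarrow>
    (\<forall>t. f differentiable (at t)) \<and> times_differentiable n (vderiv f)"
proof -
  have "(\<forall>k\<le>Suc n. P k) \<longleftrightarrow> P 0 \<and> (\<forall>k\<le>n. P (Suc k))" for P
    by (metis Suc_le_mono le0 not0_implies_Suc)
  then show ?thesis
    by (simp add: times_differentiable_def funpow_swap1)
qed

lemma times_differentiable_SucD: "times_differentiable (Suc n) f \<Longrightarrow> times_differentiable n f"
  by (simp add: times_differentiable_def)

lemma times_differentiableD: "times_differentiable n f \<Longrightarrow> f differentiable (at t)"
  by (cases n) (auto simp: times_differentiable_0 times_differentiable_Suc)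

lemma smooth_iff: "smooth f \<longleftrightarrow> (\<forall>n. times_differentiable n f)"
  by (auto simp: smooth_def times_differentiable_def)

lemma smooth_differentiable: "smooth f \<Longrightarrow> f differentiable (at t)"
  using smooth_iff times_differentiableD by blast

lemma smooth_vderiv: "smooth f \<Longrightarrow> smooth (vderiv f)"
  by (meson smooth_iff times_differentiable_Suc)

lemma has_vderiv:
  "f differentiable (at t) \<Longrightarrow> (f has_vector_derivative vderiv f t) (at t)"
  by (simp add: vderiv_def vector_derivative_works)

lemma vderiv_eqI: "(f has_vector_derivative D) (at t) \<Longrightarrow> vderiv f t = D"
  by (simp add: vderiv_def vector_derivative_at)

lemma times_differentiable_add:
  assumes "times_differentiable n f" "times_differentiable n g"
  shows "times_differentiable n (\<lambda>t. f t + g t)"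
  using assms
proof (induction n arbitrary: f g)
  case 0
  then show ?case
    by (auto simp: times_differentiable_0)
next
  case (Suc n)
  then have diff: "f differentiable (at t)" "g differentiable (at t)" for t
    by (auto intro: times_differentiableD)
  then have "vderiv (\<lambda>t. f t + g t) = (\<lambda>t. vderiv f t + vderiv g t)"
    by (intro ext vderiv_eqI has_vector_derivative_add has_vderiv)
  then show ?case
    using Suc diff by (simp add: times_differentiable_Suc)
qed

lemma has_vderiv_bilinear:
  assumes "bounded_bilinear h" "f differentiable (at t)" "g differentiable (at t)"
  shows "((\<lambda>t. h (f t) (g t)) has_vector_derivative
    h (f t) (vderiv g t) + h (vderiv f t) (g t)) (at t)"
  by (rule bounded_bilinear.has_vector_derivative[OF assms(1)]) (intro has_vderiv assms)+

lemma times_differentiable_bilinear: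
  assumes "bounded_bilinear h" "times_differentiable n f" "times_differentiable n g"
  shows "times_differentiable n (\<lambda>t. h (f t) (g t))"
  using assms(2,3)
proof (induction n arbitrary: f g)
  case 0
  then show ?case
    using has_vderiv_bilinear[OF assms(1)] differentiableI_vector
    unfolding times_differentiable_0 by blast
next
  case (Suc n)
  then have diff: "f differentiable (at t)" "g differentiable (at t)" for t
    by (auto intro: times_differentiableD)
  then have "vderiv (\<lambda>t. h (f t) (g t)) = (\<lambda>t. h (f t) (vderiv g t) + h (vderiv f t) (g t))"
    by (intro ext vderiv_eqI has_vderiv_bilinear assms(1))
  moreover have "(\<lambda>t. h (f t) (g t)) differentiable (at t)" for t
    using has_vderiv_bilinear[OF assms(1) diff] by (rule differentiableI_vector)
  moreover have "times_differentiable n (\<lambda>t. h (f t) (vderiv g t) + h (vderiv f t) (g t))"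
    using Suc.prems by (intro times_differentiable_add Suc.IH)
      (simp_all add: times_differentiable_SucD, simp_all add: times_differentiable_Suc)
  ultimately show ?case
    by (simp add: times_differentiable_Suc)
qed

lemma smooth_add: "smooth f \<Longrightarrow> smooth g \<Longrightarrow> smooth (\<lambda>t. f t + g t)"
  by (simp add: smooth_iff times_differentiable_add)

lemma smooth_bilinear:
  "bounded_bilinear h \<Longrightarrow> smooth f \<Longrightarrow> smooth g \<Longrightarrow> smooth (\<lambda>t. h (f t) (g t))"
  by (simp add: smooth_iff times_differentiable_bilinear)

lemma smooth_const: "smooth (\<lambda>t. c)"
proof -
  have zero: "vderiv (\<lambda>t. 0) = (\<lambda>t. 0)"
    by (intro ext vderiv_eqI) simp
  have "times_differentiable n (\<lambda>t. 0)" for n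
    by (induction n) (simp_all add: times_differentiable_0 times_differentiable_Suc zero)
  moreover have "vderiv (\<lambda>t. c) = (\<lambda>t. 0)"
    by (intro ext vderiv_eqI) simp
  ultimately have "times_differentiable n (\<lambda>t. c)" for n
    by (cases n) (simp_all add: times_differentiable_0 times_differentiable_Suc)
  then show ?thesis
    by (simp add: smooth_iff)
qed

lemma smooth_sum:
  "(\<And>i. i \<in> I \<Longrightarrow> smooth (f i)) \<Longrightarrow> smooth (\<lambda>t. \<Sum>i\<in>I. f i t)"
  by (induction I rule: infinite_finite_induct) (simp_all add: smooth_const smooth_add)

text \<open>
  Arclength derivatives divide by the speed. The function \<open>r = 1 / norm v\<close> solves the differential
  equation \<open>r' = - (v \<bullet> v') r\<^sup>3\<close>, whose right-hand side is polynomial in functions already known to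
  have as many derivatives, so \<open>r\<close> gains one derivative after the other.
\<close>

lemma smooth_inverse_norm:
  fixes v :: "real \<Rightarrow> 'a::real_inner"
  assumes "smooth v" and nz: "\<And>t. v t \<noteq> 0"
  shows "smooth (\<lambda>t. 1 / norm (v t))"
proof -
  define r where "r = (\<lambda>t. 1 / norm (v t))"
  have r': "(r has_vector_derivative - ((v t \<bullet> vderiv v t) * (r t * (r t * r t)))) (at t)" for t
  proof -
    have "((\<lambda>t. v t \<bullet> v t) has_real_derivative 2 * (v t \<bullet> vderiv v t)) (at t)"
      using has_vderiv_bilinear[OF bounded_bilinear_inner, of v t v] assms(1)
      by (simp add: has_real_derivative_iff_has_vector_derivative smooth_differentiable inner_commute)
    moreover have "v t \<bullet> v t > 0"
      using nz by simp
    ultimately have "((\<lambda>t. inverse (sqrt (v t \<bullet> v t))) has_real_derivative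
        - ((v t \<bullet> vderiv v t) * (r t * (r t * r t)))) (at t)"
      by (auto intro!: derivative_eq_intros simp: r_def norm_eq_sqrt_inner leD field_simps)
    then show ?thesis
      by (simp add: has_real_derivative_iff_has_vector_derivative r_def norm_eq_sqrt_inner
          inverse_eq_divide)
  qed
  have diff: "r differentiable (at t)" for t
    using r' by (rule differentiableI_vector)
  have vderiv_r: "vderiv r = (\<lambda>t. - 1 * ((v t \<bullet> vderiv v t) * (r t * (r t * r t))))"
    using r' by (intro ext vderiv_eqI) simp
  have "times_differentiable n r" for n
  proof (induction n)
    case 0
    then show ?case
      by (simp add: times_differentiable_0 diff)
  next
    case (Suc n)
    have "smooth (\<lambda>t. - 1 :: real)" "smooth (\<lambda>t. v t \<bullet> vderiv v t)"
      using assms(1) by (intro smooth_const smooth_bilinear[OF bounded_bilinear_inner] smooth_vderiv)+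
    then have "times_differentiable n (\<lambda>t. - 1 :: real)"
      "times_differentiable n (\<lambda>t. v t \<bullet> vderiv v t)"
      by (simp_all add: smooth_iff)
    then have "times_differentiable n (vderiv r)"
      unfolding vderiv_r using Suc
      by (intro times_differentiable_bilinear[OF bounded_bilinear_mult])
    then show ?case
      by (simp add: times_differentiable_Suc diff)
  qed
  then show ?thesis
    by (simp add: smooth_iff flip: r_def)
qed

section \<open>The cross product\<close>

text \<open>Reversing the order of summation changes the sign, since the triple product is antisymmetric.\<close>

lemma antisymmetric_cross_sum:
  fixes n :: nat
  shows "(\<Sum>i\<le>n. cross3 v (y i) \<bullet> y (n - i)) = 0"
proof -
  have "(\<Sum>i\<le>n. cross3 v (y i) \<bullet> y (n - i)) = (\<Sum>i\<le>n. cross3 v (y (n - i)) \<bullet> y i)"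
    by (rule sum.reindex_bij_witness[of _ "\<lambda>i. n - i" "\<lambda>i. n - i"]) auto
  also have "\<dots> = - (\<Sum>i\<le>n. cross3 v (y i) \<bullet> y (n - i))"
    unfolding sum_negf[symmetric]
    by (intro sum.cong refl) (simp add: cross3_simps)
  finally show ?thesis
    by simp
qed

lemma bounded_bilinear_cross3: "bounded_bilinear cross3"
  using bilinear_cross bilinear_conv_bounded_bilinear by blast

section \<open>The hierarchy of vector fields along an immersed curve\<close>

locale immersed_curve =
  fixes \<gamma> :: "real \<Rightarrow> real^3"
  assumes smooth_curve: "smooth \<gamma>"
    and immersion: "vderiv \<gamma> t \<noteq> 0"
begin

abbreviation "D \<equiv> arc_deriv \<gamma>"
abbreviation "T \<equiv> tangent \<gamma>"
abbreviation "Y \<equiv> Y_field \<gamma>"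

text \<open>
  As a rewrite rule, the recursion is applied to its own right-hand side without end, because the index
  \<open>k - i + 1\<close> under the sum is again a successor.
\<close>

declare Y_field.simps(2) [simp del]

lemma smooth_arc_deriv: "smooth f \<Longrightarrow> smooth (D f)"
  unfolding arc_deriv_def
  by (intro smooth_bilinear[OF bounded_bilinear_scaleR] smooth_inverse_norm smooth_vderiv
      smooth_curve immersion)

lemma smooth_Y: "smooth (Y k)"
proof (induction k rule: less_induct)
  case (less k)
  have T: "smooth T"
    unfolding tangent_def by (intro smooth_arc_deriv smooth_curve)
  show ?case
  proof (cases k)
    case 0
    then show ?thesis
      using T by simp
  next
    case (Suc m)
    have "smooth (\<lambda>t. cross3 (T t) (D (Y m) t)
       + ((-1/2) * (\<Sum>i\<in>{1..m}. Y i t \<bullet> Y (m - i + 1) t)) *\<^sub>R T t)"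
      by (intro smooth_add smooth_bilinear[OF bounded_bilinear_cross3]
          smooth_bilinear[OF bounded_bilinear_scaleR] smooth_bilinear[OF bounded_bilinear_mult]
          smooth_bilinear[OF bounded_bilinear_inner] smooth_sum smooth_const smooth_arc_deriv
          T less.IH) (auto simp: Suc)
    then show ?thesis
      by (simp add: Suc Y_field.simps(2)[of _ m])
  qed
qed

lemma differentiable_Y: "Y k differentiable (at t)"
  by (intro smooth_differentiable smooth_Y)

lemma tangent_unit: "T t \<bullet> T t = 1"
  using immersion[of t]
  by (simp add: tangent_def arc_deriv_def dot_square_norm power2_eq_square)

lemma arc_deriv_bilinear:
  assumes "bounded_bilinear h" "f differentiable (at t)" "g differentiable (at t)"
  shows "D (\<lambda>t. h (f t) (g t)) t = h (f t) (D g t) + h (D f t) (g t)"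
proof -
  interpret bounded_bilinear h by fact
  show ?thesis
    using vderiv_eqI[OF has_vderiv_bilinear[OF assms]]
    by (simp add: arc_deriv_def scaleR_left scaleR_right scaleR_add_right)
qed

lemma arc_deriv_sum:
  assumes "\<And>i. i \<in> I \<Longrightarrow> f i differentiable (at t)"
  shows "D (\<lambda>t. \<Sum>i\<in>I. f i t) t = (\<Sum>i\<in>I. D (f i) t)"
proof -
  have "vderiv (\<lambda>t. \<Sum>i\<in>I. f i t) t = (\<Sum>i\<in>I. vderiv (f i) t)"
    using assms by (intro vderiv_eqI has_vector_derivative_sum has_vderiv)
  then show ?thesis
    by (simp add: arc_deriv_def scaleR_sum_right)
qed

lemma arc_deriv_const: "D (\<lambda>t. c) t = 0"
  by (simp add: vderiv_eqI[OF has_vector_derivative_const] arc_deriv_def)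

lemma arc_deriv_diff:
  assumes "f differentiable (at t)" "g differentiable (at t)"
  shows "D (\<lambda>t. f t - g t) t = D f t - D g t"
  using vderiv_eqI[OF has_vector_derivative_diff[OF has_vderiv has_vderiv, OF assms]]
  by (simp add: arc_deriv_def scaleR_diff_right)

lemma constant_if_arc_deriv_zero:
  assumes diff: "\<And>t. f differentiable (at t)" and zero: "\<And>t. D f t = 0"
  shows "f t = f 0"
proof -
  have "(f has_vector_derivative 0) (at t)" for t
    using has_vderiv[OF diff, of t] zero[of t] immersion[of t] by (simp add: arc_deriv_def)
  then obtain c where "f t = c" for t
    using has_vector_derivative_zero_constant[of UNIV f] by auto
  then show ?thesis
    by metis
qed

text \<open>
  This is \<open>(Y, Y) = 1\<close> for the formal series \<open>Y\<close> with coefficients \<open>Y k\<close>: the multiple of \<open>T\<close> in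
  the recursion is chosen so that the terms \<open>i = 0\<close> and \<open>i = n\<close> cancel the others.
\<close>

lemma Y_inner_Y:
  "(\<Sum>i\<le>n. Y i t \<bullet> Y (n - i) t) = (if n = 0 then 1 else 0)"
proof (cases n)
  case 0
  then show ?thesis
    by (simp add: tangent_unit)
next
  case (Suc m)
  have "T t \<bullet> Y n t = - (1/2) * (\<Sum>i\<in>{1..m}. Y i t \<bullet> Y (n - i) t)"
    by (simp add: Suc Y_field.simps(2)[of _ m] inner_diff_right dot_cross_self tangent_unit
        Suc_diff_le)
  moreover have "{..n} = insert 0 (insert n {1..m})"
    by (auto simp: Suc)
  ultimately show ?thesis
    by (simp add: Suc inner_commute)
qed

text \<open>
  By construction \<open>T \<times> Y (k + 1)\<close> is \<open>T \<times> (T \<times> D (Y k))\<close>, which is the negative of the normal part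
  of \<open>D (Y k)\<close>. What has to be shown is that \<open>D (Y k)\<close> has no tangential part. Differentiating
  \<open>(Y, Y) = 1\<close> at order \<open>k\<close> expresses the tangential part by the derivatives of the earlier fields,
  and these, inserted from the induction hypothesis, give an antisymmetric sum of triple products.
\<close>

lemma arc_deriv_Y: "D (Y k) t = - cross3 (T t) (Y (Suc k) t)"
proof (induction k rule: less_induct)
  case (less k)
  have "0 = D (\<lambda>t. \<Sum>i\<le>k. Y i t \<bullet> Y (k - i) t) t"
    unfolding Y_inner_Y by (rule arc_deriv_const[symmetric])
  also have "\<dots> = (\<Sum>i\<le>k. Y i t \<bullet> D (Y (k - i)) t + D (Y i) t \<bullet> Y (k - i) t)"
    by (subst arc_deriv_sum)
      (auto intro!: sum.cong arc_deriv_bilinear[OF bounded_bilinear_inner] differentiable_inner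
        differentiable_Y)
  also have "\<dots> = 2 * (\<Sum>i\<le>k. D (Y i) t \<bullet> Y (k - i) t)"
  proof -
    have "(\<Sum>i\<le>k. Y i t \<bullet> D (Y (k - i)) t) = (\<Sum>i\<le>k. D (Y i) t \<bullet> Y (k - i) t)"
      by (rule sum.reindex_bij_witness[of _ "\<lambda>i. k - i" "\<lambda>i. k - i"]) (auto simp: inner_commute)
    then show ?thesis
      by (simp add: sum.distrib)
  qed
  also have "(\<Sum>i\<le>k. D (Y i) t \<bullet> Y (k - i) t) =
      D (Y k) t \<bullet> T t - (\<Sum>i<k. cross3 (T t) (Y (Suc i) t) \<bullet> Y (k - i) t)"
    using less.IH by (simp add: lessThan_Suc_atMost[symmetric] sum_negf)
  \<comment> \<open>the sum is completed to an antisymmetric one by the index 0, where the cross product is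
    \<open>T \<times> T\<close>, and by \<open>k + 1\<close>, where the second factor is \<open>T\<close>\<close>
  also have "(\<Sum>i<k. cross3 (T t) (Y (Suc i) t) \<bullet> Y (k - i) t) =
      (\<Sum>i\<le>Suc k. cross3 (T t) (Y i t) \<bullet> Y (Suc k - i) t)"
    unfolding sum.atMost_Suc_shift
    by (simp add: lessThan_Suc_atMost[symmetric] dot_cross_self)
  also have "\<dots> = 0"
    by (rule antisymmetric_cross_sum)
  finally have orth: "T t \<bullet> D (Y k) t = 0"
    by (simp add: inner_commute)
  have "cross3 (T t) (Y (Suc k) t) = cross3 (T t) (cross3 (T t) (D (Y k) t))"
    by (simp add: Y_field.simps(2)[of _ k] cross_mult_right Cross3.right_diff_distrib)
  also have "\<dots> = - D (Y k) t"
    using orth by (simp add: Lagrange tangent_unit)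
  finally show ?case
    by simp
qed

section \<open>Solutions of the chain of equations\<close>

text \<open>
  The coefficient at the power \<open>-k\<close> of the product of \<open>Y\<close> with the series in the inverse of \<open>\<lambda>\<close>
  that has the constant coefficients \<open>a\<close>.
\<close>

definition Y_combination :: "(nat \<Rightarrow> real) \<Rightarrow> nat \<Rightarrow> real \<Rightarrow> real^3" where
  "Y_combination a k t = (\<Sum>j\<le>k. a j *\<^sub>R Y (k - j) t)"

lemma differentiable_Y_combination: "Y_combination a k differentiable (at t)"
  unfolding Y_combination_def[abs_def]
  by (intro smooth_differentiable smooth_sum smooth_bilinear[OF bounded_bilinear_scaleR]
      smooth_const smooth_Y)

lemma cross_sum_right: "cross3 v (\<Sum>i\<in>I. f i) = (\<Sum>i\<in>I. cross3 v (f i))"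
  by (rule linear_sum[OF bounded_linear.linear,
        OF bounded_bilinear.bounded_linear_right[OF bounded_bilinear_cross3]])

text \<open>The last term of the combination, a multiple of \<open>Y 0 = T\<close>, is lost.\<close>

lemma cross_Y_combination_Suc:
  "cross3 (T t) (Y_combination a (Suc k) t)
    = (\<Sum>j\<le>k. a j *\<^sub>R cross3 (T t) (Y (Suc k - j) t))"
  by (simp add: Y_combination_def cross_sum_right cross_mult_right cross_add_right)

lemma arc_deriv_Y_combination:
  "D (Y_combination a k) t = - cross3 (T t) (Y_combination a (Suc k) t)"
proof -
  have "D (Y_combination a k) t = (\<Sum>j\<le>k. D (\<lambda>t. a j *\<^sub>R Y (k - j) t) t)"
    unfolding Y_combination_def[abs_def]
    by (intro arc_deriv_sum smooth_differentiable smooth_bilinear[OF bounded_bilinear_scaleR]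
        smooth_const smooth_Y)
  also have "\<dots> = (\<Sum>j\<le>k. a j *\<^sub>R D (Y (k - j)) t)"
    by (simp add: arc_deriv_bilinear[OF bounded_bilinear_scaleR] arc_deriv_const differentiable_Y)
  also have "\<dots> = - cross3 (T t) (Y_combination a (Suc k) t)"
    unfolding cross_Y_combination_Suc
    by (simp add: arc_deriv_Y Suc_diff_le sum_negf)
  finally show ?thesis .
qed

text \<open>
  The coefficient \<open>a (d + 1)\<close> multiplies \<open>T\<close> and is free, so the multipliers correspond to
  \<open>a 1, ..., a d\<close> in reverse order.
\<close>

lemma constrained_critical_iff:
  "constrained_critical d \<gamma> \<longleftrightarrow>
    (\<exists>a. a 0 = 1 \<and> (\<forall>t. cross3 (T t) (Y_combination a (Suc d) t) = 0))"
    (is "?L \<longleftrightarrow> ?R")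
proof -
  have split: "cross3 (T t) (Y_combination a (Suc d) t) =
      G_gradient \<gamma> (d + 1) t + (\<Sum>i\<in>{1..d}. a (Suc d - i) *\<^sub>R G_gradient \<gamma> i t)"
    if "a 0 = 1" for a t
  proof -
    have "{..d} = insert 0 {1..d}"
      by auto
    then have "cross3 (T t) (Y_combination a (Suc d) t) = G_gradient \<gamma> (d + 1) t
        + (\<Sum>j\<in>{1..d}. a j *\<^sub>R G_gradient \<gamma> (Suc d - j) t)"
      using that by (simp add: cross_Y_combination_Suc G_gradient_def)
    also have "(\<Sum>j\<in>{1..d}. a j *\<^sub>R G_gradient \<gamma> (Suc d - j) t)
        = (\<Sum>i\<in>{1..d}. a (Suc d - i) *\<^sub>R G_gradient \<gamma> i t)"
      by (rule sum.reindex_bij_witness[of _ "\<lambda>i. Suc d - i" "\<lambda>i. Suc d - i"]) auto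
    finally show ?thesis .
  qed
  show ?thesis
  proof
    assume ?L
    then obtain c where c: "G_gradient \<gamma> (d + 1) t = (\<Sum>i\<in>{1..d}. c i *\<^sub>R G_gradient \<gamma> i t)" for t
      unfolding constrained_critical_def by blast
    define a where "a j = (if j = 0 then 1 else - c (Suc d - j))" for j
    have "(\<Sum>i\<in>{1..d}. a (Suc d - i) *\<^sub>R G_gradient \<gamma> i t) = - G_gradient \<gamma> (d + 1) t" for t
      unfolding c sum_negf[symmetric] by (rule sum.cong) (auto simp: a_def)
    then have "cross3 (T t) (Y_combination a (Suc d) t) = 0" for t
      using split[of a t] by (simp add: a_def)
    then show ?R
      by (intro exI[of _ a]) (simp add: a_def)
  next
    assume ?R
    then obtain a where a: "a 0 = 1" and zero: "\<And>t. cross3 (T t) (Y_combination a (Suc d) t) = 0"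
      by blast
    have "G_gradient \<gamma> (d + 1) t = (\<Sum>i\<in>{1..d}. (- a (Suc d - i)) *\<^sub>R G_gradient \<gamma> i t)" for t
      using split[of a t, OF a] zero[of t] by (simp add: sum_negf eq_neg_iff_add_eq_0)
    then show ?L
      unfolding constrained_critical_def
      by (intro exI[of _ "\<lambda>i. - a (Suc d - i)"]) blast
  qed
qed

text \<open>
  Two solutions of the chain that agree up to \<open>n\<close> differ at \<open>n + 1\<close> by some \<open>\<eta>\<close> parallel to \<open>T\<close>.
  The tangential component of \<open>\<eta>\<close> is constant because both \<open>D \<eta>\<close>, by the chain at \<open>n + 1\<close>, and
  \<open>D T\<close> are normal. Adding this constant to \<open>a (n + 1)\<close> removes the difference and affects no
  earlier coefficient.
\<close>

lemma eq_Y_combination: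
  assumes diff: "\<And>k t. x k differentiable (at t)"
    and flow: "\<And>k t. D (x k) t = - cross3 (T t) (x (Suc k) t)"
    and start: "x 0 = T"
  shows "\<exists>a. a 0 = 1 \<and> (\<forall>k\<le>n. x k = Y_combination a k)"
proof (induction n)
  case 0
  show ?case
    \<comment> \<open>the values beyond index 0 are arbitrary at this stage\<close>
    by (rule exI[of _ "\<lambda>_. 1"]) (simp add: start Y_combination_def fun_eq_iff)
next
  case (Suc n)
  then obtain a where a0: "a 0 = 1" and a: "\<And>k. k \<le> n \<Longrightarrow> x k = Y_combination a k"
    by blast
  define \<eta> where "\<eta> = (\<lambda>t. x (Suc n) t - Y_combination a (Suc n) t)"
  have diff_\<eta>: "\<eta> differentiable (at t)" for t
    unfolding \<eta>_def by (intro differentiable_diff diff differentiable_Y_combination)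
  have diff_T: "T differentiable (at t)" for t
    using differentiable_Y[of 0] by simp
  have "cross3 (T t) (\<eta> t) = 0" for t
    using flow[of n t] arc_deriv_Y_combination[of a n t] a[of n]
    by (simp add: \<eta>_def Cross3.right_diff_distrib)
  then have parallel: "\<eta> t = (T t \<bullet> \<eta> t) *\<^sub>R T t" for t
    using Lagrange[of "T t" "T t" "\<eta> t"] by (simp add: tangent_unit cross_zero_right)
  have "D (\<lambda>t. T t \<bullet> \<eta> t) t = 0" for t
  proof -
    have "D \<eta> t = - cross3 (T t) (x (Suc (Suc n)) t - Y_combination a (Suc (Suc n)) t)"
      unfolding \<eta>_def
      by (simp add: arc_deriv_diff diff differentiable_Y_combination flow
          arc_deriv_Y_combination Cross3.right_diff_distrib)
    then have "T t \<bullet> D \<eta> t = 0"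
      by (simp add: dot_cross_self)
    moreover have "D T t \<bullet> T t = 0"
      using arc_deriv_Y[of 0 t] by (simp add: dot_cross_self)
    then have "D T t \<bullet> \<eta> t = 0"
      by (subst parallel) simp
    ultimately show ?thesis
      by (simp add: arc_deriv_bilinear[OF bounded_bilinear_inner] diff_T diff_\<eta>)
  qed
  then have const: "T t \<bullet> \<eta> t = T 0 \<bullet> \<eta> 0" for t
    by (intro constant_if_arc_deriv_zero[of "\<lambda>t. T t \<bullet> \<eta> t"] differentiable_inner diff_T diff_\<eta>)
  define b where "b = a(Suc n := a (Suc n) + T 0 \<bullet> \<eta> 0)"
  have "x k = Y_combination b k" if "k \<le> n" for k
    using a[OF that] that by (auto simp: Y_combination_def b_def fun_eq_iff intro!: sum.cong)
  moreover have "x (Suc n) t = Y_combination b (Suc n) t" for t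
  proof -
    have "Y_combination b (Suc n) t = Y_combination a (Suc n) t + (T 0 \<bullet> \<eta> 0) *\<^sub>R T t"
      by (simp add: Y_combination_def b_def scaleR_add_left)
    also have "\<dots> = Y_combination a (Suc n) t + \<eta> t"
      using parallel[of t] const[of t] by metis
    also have "\<dots> = x (Suc n) t"
      by (simp add: \<eta>_def)
    finally show ?thesis
      by simp
  qed
  ultimately have "\<forall>k\<le>Suc n. x k = Y_combination b k"
    by (auto simp: le_Suc_eq)
  moreover have "b 0 = 1"
    by (simp add: b_def a0)
  ultimately show ?case
    by blast
qed

end

section \<open>The lowest order flow in coefficients\<close>

lemma finite_laurent_support:
  assumes "\<xi> \<in> laurent_space d"
  shows "finite {m. \<xi> m \<noteq> 0}"
proof -
  have "{m. \<xi> m \<noteq> 0} \<subseteq> {- int d..0}"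
    using assms by (auto simp: laurent_space_def)
  then show ?thesis
    by (rule finite_subset) simp
qed

text \<open>Only the term \<open>\<lambda> \<xi>\<^sub>0\<close> of \<open>\<lambda> \<xi>\<close> has a positive power.\<close>

lemma V0_eq:
  assumes "\<xi> \<in> laurent_space d"
  shows "V0 \<xi> n = - cross3 (\<xi> 0) (\<xi> (n - 1))"
proof -
  let ?h = "\<lambda>m. cross3 (\<xi> m) (positive_part (lambda_mult \<xi>) (n - m))"
  have zero: "\<xi> m = 0" if "m \<notin> {- int d..0}" for m
    using assms that by (simp add: laurent_space_def)
  have other: "?h m = 0" if "m \<noteq> n - 1" for m
    using that zero[of "n - m - 1"] by (auto simp: positive_part_def lambda_mult_def)
  have "finite {m. \<xi> m \<noteq> 0}"
    by (rule finite_laurent_support[OF assms])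
  then have "V0 \<xi> n = sum ?h {n - 1}"
    unfolding V0_def laurent_cross_def
    using other by (intro sum.mono_neutral_cong) auto
  also have "\<dots> = - cross3 (\<xi> 0) (\<xi> (n - 1))"
    using cross_skew[of "\<xi> (n - 1)" "\<xi> 0"] by (simp add: positive_part_def lambda_mult_def)
  finally show ?thesis .
qed

text \<open>
  There are no positive powers to pair with the negative ones, so being normalized says that the
  leading coefficient is a unit vector.
\<close>

lemma laurent_inner_zeroth:
  assumes "\<xi> \<in> laurent_space d"
  shows "laurent_inner \<xi> \<xi> 0 = \<xi> 0 \<bullet> \<xi> 0"
proof -
  have zero: "\<xi> m = 0" if "m \<notin> {- int d..0}" for m
    using assms that by (simp add: laurent_space_def)
  have "finite {m. \<xi> m \<noteq> 0}"
    by (rule finite_laurent_support[OF assms])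
  moreover have "\<xi> m \<bullet> \<xi> (0 - m) = 0" if "m \<noteq> 0" for m
    using that zero[of m] zero[of "- m"] by (cases "m > 0") auto
  ultimately have "laurent_inner \<xi> \<xi> 0 = (\<Sum>m\<in>{0}. \<xi> m \<bullet> \<xi> (0 - m))"
    unfolding laurent_inner_def by (intro sum.mono_neutral_cong) auto
  then show ?thesis
    by simp
qed

theorem theorem11:
  fixes \<tau> :: "real \<Rightarrow> real" and A :: "real^3^3" and a :: "real^3"
    and \<gamma> :: "real \<Rightarrow> real^3" and d :: nat
  assumes "translation \<tau>"
    and "rotation_matrix A"
    and "\<gamma> \<in> immersions_with_monodromy \<tau> (motion A a)"
  shows "constrained_critical d \<gamma> \<longleftrightarrow>
    (\<exists>\<xi>. solves_V0_flow d \<gamma> \<xi> \<and> (\<forall>t. normalized (\<xi> t)) \<and> (\<forall>t. tangent \<gamma> t = \<xi> t 0))"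
    (is "_ \<longleftrightarrow> ?solution")
proof -
  interpret immersed_curve \<gamma>
    using assms(3) by unfold_locales (auto simp: immersions_with_monodromy_def)
  show ?thesis
    unfolding constrained_critical_iff
  proof
    assume "\<exists>a. a 0 = 1 \<and> (\<forall>t. cross3 (T t) (Y_combination a (Suc d) t) = 0)"
    then obtain a where a: "a 0 = 1"
      and closed: "\<And>t. cross3 (T t) (Y_combination a (Suc d) t) = 0"
      by blast
    define \<xi> where "\<xi> = (\<lambda>t n. if n \<in> {- int d..0} then Y_combination a (nat (- n)) t else 0)"
    have space: "\<xi> t \<in> laurent_space d" for t
      by (auto simp: \<xi>_def laurent_space_def)
    have \<xi>0: "\<xi> t 0 = T t" for t
      by (simp add: \<xi>_def Y_combination_def a)
    have "D (\<lambda>s. \<xi> s n) t = V0 (\<xi> t) n" for n t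
    proof (cases "n \<in> {- int d..0}")
      case True
      define k where "k = nat (- n)"
      have n: "n = - int k" and "k \<le> d"
        using True by (auto simp: k_def)
      have "D (\<lambda>s. \<xi> s n) t = - cross3 (T t) (Y_combination a (Suc k) t)"
        using \<open>k \<le> d\<close> arc_deriv_Y_combination[of a k t] by (simp add: \<xi>_def n)
      \<comment> \<open>for \<open>k < d\<close> this is the definition; for \<open>k = d\<close> the chain was cut off, and criticality makes
        the left-hand side vanish as well\<close>
      also have "\<dots> = - cross3 (\<xi> t 0) (\<xi> t (n - 1))"
      proof (cases "k = d")
        case True
        then show ?thesis
          using closed by (simp add: \<xi>_def n)
      next
        case False
        then have "\<xi> t (n - 1) = Y_combination a (Suc k) t"
          using \<open>k \<le> d\<close> by (simp add: \<xi>_def n nat_add_distrib)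
        then show ?thesis
          by (simp add: \<xi>0)
      qed
      finally show ?thesis
        by (simp add: V0_eq[OF space])
    next
      case False
      have "V0 (\<xi> t) n = 0"
      \<comment> \<open>at \<open>n = 1\<close> the flow is \<open>- \<xi>\<^sub>0 \<times> \<xi>\<^sub>0\<close>\<close>
      proof (cases "n = 1")
        case True
        then show ?thesis
          by (simp add: V0_eq[OF space])
      next
        case False
        then have "\<xi> t (n - 1) = 0"
          using \<open>n \<notin> _\<close> by (auto simp: \<xi>_def)
        then show ?thesis
          by (simp add: V0_eq[OF space])
      qed
      moreover have "(\<lambda>s. \<xi> s n) = (\<lambda>s. 0)"
        using False by (auto simp: \<xi>_def)
      ultimately show ?thesis
        by (simp add: arc_deriv_const)
    qed
    moreover have "(\<lambda>s. \<xi> s n) differentiable (at t)" for n t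
      using differentiable_Y_combination
      by (cases "n \<in> {- int d..0}") (auto simp: \<xi>_def)
    ultimately have "solves_V0_flow d \<gamma> \<xi>"
      using space by (simp add: solves_V0_flow_def)
    moreover have "normalized (\<xi> t)" for t
      by (simp add: normalized_def laurent_inner_zeroth[OF space] \<xi>0 tangent_unit)
    ultimately show ?solution
      using \<xi>0 by (intro exI[of _ \<xi>]) simp
  next
    assume ?solution
    then obtain \<xi> where space: "\<And>t. \<xi> t \<in> laurent_space d"
      and diff: "\<And>n t. (\<lambda>s. \<xi> s n) differentiable (at t)"
      and flow: "\<And>n t. D (\<lambda>s. \<xi> s n) t = V0 (\<xi> t) n"
      and \<xi>0: "\<And>t. T t = \<xi> t 0"
      by (auto simp: solves_V0_flow_def)
    define x where "x k = (\<lambda>t. \<xi> t (- int k))" for k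
    have "\<exists>a. a 0 = 1 \<and> (\<forall>k\<le>Suc d. x k = Y_combination a k)"
    proof (rule eq_Y_combination)
      show "x k differentiable (at t)" for k t
        unfolding x_def by (rule diff)
      show "D (x k) t = - cross3 (T t) (x (Suc k) t)" for k t
        by (simp add: x_def flow V0_eq[OF space] \<xi>0 minus_diff_commute)
      show "x 0 = T"
        by (simp add: x_def \<xi>0 fun_eq_iff)
    qed
    then obtain a where a: "a 0 = 1" and "x (Suc d) = Y_combination a (Suc d)"
      by blast
    moreover have "x (Suc d) t = 0" for t
      using space[of t] by (simp add: x_def laurent_space_def)
    ultimately have "Y_combination a (Suc d) t = 0" for t
      by metis
    then show "\<exists>a. a 0 = 1 \<and> (\<forall>t. cross3 (T t) (Y_combination a (Suc d) t) = 0)"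
      using a by (intro exI[of _ a]) (simp add: cross_zero_right)
  qed
qed

end
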